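(* Let $C$ be an $(n,k)_q$-MDS code over an alphabet $\mathcal{A}$ of size $q$ with $0\in\mathcal{A}$, and suppose that $C$ contains the all-zero codeword $\bar 0$. Let $W(C)$ denote the set of Hamming weights of the codewords of $C$ other than $\bar 0$. (1) If $n<q+k-1$, then $W(C)=\{n,n-1,\ldots,n-k+1\}$. (2) If $n=q+k-1$ and $k,q>2$, then $W(C)=\{n,n-1,\ldots,n-k+3,\,n-k+1\}$, that is, $W(C)=\{n,n-1,\ldots,n-k+1\}\setminus\{n-k+2\}$.
   Context: Let $\mathcal{A}$ be a finite alphabet of size $q\ge 2$ ($q$ need not be a prime power) containing a distinguished symbol $0$, and let $1\le k\le n$ be integers. The Hamming distance $d(a,b)$ of $a,b\in\mathcal{A}^n$ is the number of coordinates in which they differ. An $(n,k)_q$ code is a subset $C\subseteq\mathcal{A}^n$ with $|C|=q^k$; no linearity is assumed. Its minimum distance $d$ is the minimum Hamming distance between distinct codewords; it satisfies the Singleton bound $d\le n-k+1$, and $C$ is called an $(n,k)_q$-MDS code if $d=n-k+1$. The word $\bar 0$ is the word with all coordinates $0$, and the Hamming weight of a word $c$ is $d(c,\bar 0)$, the number of its nonzero coordinates. The weight spectrum is $W(C)=\{d(c,\bar 0) : c\in C\setminus\{\bar 0\}\}$. *)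

theory Defs
  imports Complex_Main "HOL-Library.FuncSet"
begin

text \<open>
  Words of length \<open>n\<close> over an alphabet \<open>A\<close> are extensional functions on the coordinate
  set \<open>{..<n}\<close>, so that distinct words differ in at least one coordinate.
\<close>

definition words :: "'a set \<Rightarrow> nat \<Rightarrow> (nat \<Rightarrow> 'a) set" where
  "words A n = {..<n} \<rightarrow>\<^sub>E A"

definition hamming_dist :: "nat \<Rightarrow> (nat \<Rightarrow> 'a) \<Rightarrow> (nat \<Rightarrow> 'a) \<Rightarrow> nat" where
  "hamming_dist n a b = card {i \<in> {..<n}. a i \<noteq> b i}"

definition zero_word :: "'a \<Rightarrow> nat \<Rightarrow> (nat \<Rightarrow> 'a)" where
  "zero_word z n = (\<lambda>i\<in>{..<n}. z)"

definition hamming_weight :: "'a \<Rightarrow> nat \<Rightarrow> (nat \<Rightarrow> 'a) \<Rightarrow> nat" where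
  "hamming_weight z n c = hamming_dist n c (zero_word z n)"

definition is_code :: "'a set \<Rightarrow> nat \<Rightarrow> nat \<Rightarrow> (nat \<Rightarrow> 'a) set \<Rightarrow> bool" where
  "is_code A n k C \<longleftrightarrow> C \<subseteq> words A n \<and> card C = card A ^ k"

text \<open>Only meaningful for finite codes with at least two codewords.\<close>

definition min_dist :: "nat \<Rightarrow> (nat \<Rightarrow> 'a) set \<Rightarrow> nat" where
  "min_dist n C = Min {hamming_dist n a b | a b. a \<in> C \<and> b \<in> C \<and> a \<noteq> b}"

definition is_MDS_code :: "'a set \<Rightarrow> nat \<Rightarrow> nat \<Rightarrow> (nat \<Rightarrow> 'a) set \<Rightarrow> bool" where
  "is_MDS_code A n k C \<longleftrightarrow> is_code A n k C \<and> min_dist n C = n - k + 1"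

definition weight_spectrum :: "'a \<Rightarrow> nat \<Rightarrow> (nat \<Rightarrow> 'a) set \<Rightarrow> nat set" where
  "weight_spectrum z n C = hamming_weight z n ` (C - {zero_word z n})"

end

theory Submission
  imports Defs
begin

text \<open>
  Put \<open>d = n - k + 1\<close>. Fixing the values on \<open>k - 1\<close> coordinates \<open>Q\<close> leaves a pencil of \<open>q\<close>
  codewords, and at each of the \<open>d\<close> coordinates outside \<open>Q\<close> exactly one word of the pencil
  is zero. If \<open>d < q\<close>, or if \<open>d = q\<close> and some word of the pencil has two zeros outside \<open>Q\<close>,
  then some word of the pencil has no zero outside \<open>Q\<close>. Letting \<open>Q\<close> consist of the complement of a
  given set \<open>S\<close> and of some points of \<open>S\<close> with nonzero values, one obtains a codeword with support
  \<open>S\<close>; for \<open>d = q\<close> the required pencil comes inductively from a codeword with smaller support.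
  If \<open>d = q\<close> and \<open>card S = d + 1\<close>, then each word of the pencil has exactly one zero outside \<open>Q\<close>,
  so that \<open>S\<close> is not a support.
\<close>

definition support :: "'a \<Rightarrow> nat \<Rightarrow> (nat \<Rightarrow> 'a) \<Rightarrow> nat set" where
  "support z n c = {i \<in> {..<n}. c i \<noteq> z}"

lemma support_subset: "support z n c \<subseteq> {..<n}"
  by (auto simp: support_def)

lemma hamming_weight_eq_card_support: "hamming_weight z n c = card (support z n c)"
  unfolding hamming_weight_def hamming_dist_def support_def zero_word_def
  by (rule arg_cong[of _ _ card]) auto

locale mds_code =
  fixes A :: "'a set" and z :: 'a and n k :: nat and C :: "(nat \<Rightarrow> 'a) set"
  assumes finite_A: "finite A" and card_A: "2 \<le> card A" and z_in: "z \<in> A"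
    and k_pos: "1 \<le> k" and k_le: "k \<le> n"
    and mds: "is_MDS_code A n k C"
    and zero_in: "zero_word z n \<in> C"
begin

lemma C_subset: "C \<subseteq> words A n" and card_C: "card C = card A ^ k"
  using mds by (auto simp: is_MDS_code_def is_code_def)

text \<open>\<open>card\<close> is 0 on infinite sets, so the positive cardinality of
  \<open>C\<close> already forces finiteness.\<close>

lemma finite_C: "finite C"
proof (rule card_ge_0_finite)
  show "0 < card C" using card_C card_A by simp
qed

section \<open>Codewords determined by \<open>k\<close> coordinates\<close>

lemma hamming_dist_ge:
  assumes "a \<in> C" "b \<in> C" "a \<noteq> b"
  shows "n - k + 1 \<le> hamming_dist n a b"
proof -
  let ?D = "{hamming_dist n a b | a b. a \<in> C \<and> b \<in> C \<and> a \<noteq> b}"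
  have "?D \<subseteq> (\<lambda>(a, b). hamming_dist n a b) ` (C \<times> C)" by auto
  then have "finite ?D" using finite_C by (meson finite_SigmaI finite_imageI finite_subset)
  then have "Min ?D \<le> hamming_dist n a b" using assms by (intro Min_le) auto
  then show ?thesis using mds by (simp add: is_MDS_code_def min_dist_def)
qed

lemma in_alphabet: "c \<in> C \<Longrightarrow> i < n \<Longrightarrow> c i \<in> A"
  using C_subset by (auto simp: words_def)

text \<open>Agreement on \<open>k\<close> or more coordinates leaves at most \<open>n - k\<close>
  places to differ, fewer than the minimum distance.\<close>

lemma eq_if_agree:
  assumes "a \<in> C" "b \<in> C" and T: "T \<subseteq> {..<n}" "k \<le> card T" and agree: "\<And>i. i \<in> T \<Longrightarrow> a i = b i"
  shows "a = b"
proof (rule ccontr)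
  assume "a \<noteq> b"
  then have "n - k + 1 \<le> hamming_dist n a b" using assms hamming_dist_ge by blast
  also have "\<dots> \<le> card ({..<n} - T)"
    unfolding hamming_dist_def using agree by (intro card_mono) auto
  also have "\<dots> = n - card T" using T by (simp add: card_Diff_subset finite_subset)
  finally show False using T(2) k_le by simp
qed

lemma eq_zero_if_zeros:
  assumes "c \<in> C" "T \<subseteq> {..<n}" "k \<le> card T" "\<And>i. i \<in> T \<Longrightarrow> c i = z"
  shows "c = zero_word z n"
  using assms zero_in by (intro eq_if_agree[of _ _ T]) (auto simp: zero_word_def)

text \<open>Restriction to \<open>T\<close> is injective on \<open>C\<close>, and \<open>C\<close>
  is exactly as large as \<open>T \<rightarrow>\<^sub>E A\<close>, so restriction is also onto: any
  \<open>k\<close> coordinates form an information set.\<close>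

lemma interpolation:
  assumes T: "T \<subseteq> {..<n}" "card T = k" and v: "\<And>i. i \<in> T \<Longrightarrow> v i \<in> A"
  shows "\<exists>c\<in>C. \<forall>i\<in>T. c i = v i"
proof -
  have fT: "finite T" using T(1) by (rule finite_subset) simp
  have inj: "inj_on (\<lambda>c. restrict c T) C"
  proof (rule inj_onI)
    fix a b assume "a \<in> C" "b \<in> C" and eq: "restrict a T = restrict b T"
    have "a i = b i" if "i \<in> T" for i
      using fun_cong[OF eq, of i] that by simp
    then show "a = b" using \<open>a \<in> C\<close> \<open>b \<in> C\<close> T by (intro eq_if_agree[of a b T]) auto
  qed
  have sub: "(\<lambda>c. restrict c T) ` C \<subseteq> T \<rightarrow>\<^sub>E A"
    using in_alphabet T(1) by (auto simp: subset_iff)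
  have "(\<lambda>c. restrict c T) ` C = T \<rightarrow>\<^sub>E A"
    using finite_A fT T(2) card_C
    by (intro card_subset_eq sub finite_PiE) (auto simp: card_image[OF inj] card_PiE)
  moreover have "restrict v T \<in> T \<rightarrow>\<^sub>E A" using v by auto
  ultimately have "restrict v T \<in> (\<lambda>c. restrict c T) ` C" by simp
  then obtain c where "c \<in> C" "restrict v T = restrict c T" by blast
  then show ?thesis by (metis restrict_apply')
qed

section \<open>Pencils: codewords with \<open>k - 1\<close> coordinates fixed\<close>

definition pencil :: "(nat \<Rightarrow> 'a) \<Rightarrow> nat set \<Rightarrow> (nat \<Rightarrow> 'a) set" where
  "pencil c Q = {b \<in> C. \<forall>i\<in>Q. b i = c i}"

lemma card_Compl:
  assumes "Q \<subseteq> {..<n}" "card Q = k - 1"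
  shows "card ({..<n} - Q) = n - k + 1"
  using assms k_pos k_le by (simp add: card_Diff_subset finite_subset)

text \<open>Since \<open>insert r Q\<close> has \<open>k\<close> elements, agreement there gives
  injectivity and interpolation there gives surjectivity.\<close>

lemma bij_betw_pencil:
  assumes c: "c \<in> C" and Q: "Q \<subseteq> {..<n}" "card Q = k - 1" and r: "r \<in> {..<n} - Q"
  shows "bij_betw (\<lambda>b. b r) (pencil c Q) A"
proof -
  have fQ: "finite Q" using Q(1) by (rule finite_subset) simp
  have card: "card (insert r Q) = k" using Q r k_pos fQ by simp
  show ?thesis
  proof (rule bij_betw_imageI)
    show "inj_on (\<lambda>b. b r) (pencil c Q)"
    proof (rule inj_onI)
      fix a b assume "a \<in> pencil c Q" "b \<in> pencil c Q" "a r = b r"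
      then show "a = b" using Q r card
        by (intro eq_if_agree[of a b "insert r Q"]) (auto simp: pencil_def)
    qed
    show "(\<lambda>b. b r) ` pencil c Q = A"
    proof
      show "(\<lambda>b. b r) ` pencil c Q \<subseteq> A" using in_alphabet r by (auto simp: pencil_def)
      show "A \<subseteq> (\<lambda>b. b r) ` pencil c Q"
      proof
        fix x assume "x \<in> A"
        then have "\<exists>b\<in>C. \<forall>i\<in>insert r Q. b i = (c(r := x)) i"
          using Q r card c in_alphabet by (intro interpolation) auto
        then obtain b where b: "b \<in> C" "\<And>i. i \<in> insert r Q \<Longrightarrow> b i = (c(r := x)) i" by blast
        have "b \<in> pencil c Q" using b r by (auto simp: pencil_def)
        moreover have "b r = x" using b by simp
        ultimately show "x \<in> (\<lambda>b. b r) ` pencil c Q" by blast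
      qed
    qed
  qed
qed

lemma card_pencil:
  assumes "c \<in> C" "Q \<subseteq> {..<n}" "card Q = k - 1"
  shows "card (pencil c Q) = card A"
proof -
  have "{..<n} - Q \<noteq> {}" using card_Compl[OF assms(2,3)] by force
  then show ?thesis using bij_betw_pencil[OF assms] bij_betw_same_card by blast
qed

text \<open>\<open>g r\<close> is the one word of the pencil that vanishes at \<open>r\<close>.
  Hence the image of \<open>g\<close> consists of the words with some zero outside \<open>Q\<close>;
  its size decides both existence and nonexistence of supports.\<close>

lemma pencil_zeros:
  assumes "c \<in> C" "Q \<subseteq> {..<n}" "card Q = k - 1"
  obtains g where "g ` ({..<n} - Q) \<subseteq> pencil c Q"
    and "\<And>r b. r \<in> {..<n} - Q \<Longrightarrow> b \<in> pencil c Q \<Longrightarrow> b r = z \<longleftrightarrow> b = g r"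
proof
  let ?g = "\<lambda>r. inv_into (pencil c Q) (\<lambda>b. b r) z"
  note bij = bij_betw_pencil[OF assms]
  show "?g ` ({..<n} - Q) \<subseteq> pencil c Q"
  proof
    fix b assume "b \<in> ?g ` ({..<n} - Q)"
    then obtain r where r: "r \<in> {..<n} - Q" "b = ?g r" by blast
    show "b \<in> pencil c Q"
      unfolding r(2) using bij[OF r(1)] z_in by (intro inv_into_into) (simp add: bij_betw_def)
  qed
  fix r b assume r: "r \<in> {..<n} - Q" and b: "b \<in> pencil c Q"
  show "b r = z \<longleftrightarrow> b = ?g r"
    using bij_betw_inv_into_left[OF bij[OF r] b] bij_betw_inv_into_right[OF bij[OF r] z_in] by metis
qed

lemma nowhere_zero_in_pencil:
  assumes c: "c \<in> C" and Q: "Q \<subseteq> {..<n}" "card Q = k - 1"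
    and less: "n - k + 1 < card A \<or> n - k + 1 = card A \<and>
      (\<exists>r\<in>{..<n} - Q. \<exists>s\<in>{..<n} - Q. r \<noteq> s \<and> c r = z \<and> c s = z)"
  shows "\<exists>b \<in> C. (\<forall>i\<in>Q. b i = c i) \<and> (\<forall>i\<in>{..<n} - Q. b i \<noteq> z)"
proof -
  let ?R = "{..<n} - Q"
  obtain g where g: "g ` ?R \<subseteq> pencil c Q"
    and iff: "\<And>r b. r \<in> ?R \<Longrightarrow> b \<in> pencil c Q \<Longrightarrow> b r = z \<longleftrightarrow> b = g r"
    using pencil_zeros[OF c Q] by blast
  have le: "card (g ` ?R) \<le> n - k + 1"
    using card_image_le[of ?R g] card_Compl[OF Q] by simp
  have "card (g ` ?R) < card A"
    using less
  proof
    assume "n - k + 1 < card A"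
    then show ?thesis using le by simp
  next
    assume d: "n - k + 1 = card A \<and> (\<exists>r\<in>?R. \<exists>s\<in>?R. r \<noteq> s \<and> c r = z \<and> c s = z)"
    then obtain r s where rs: "r \<in> ?R" "s \<in> ?R" "r \<noteq> s" "c r = z" "c s = z" by blast
    have "c \<in> pencil c Q" using c by (simp add: pencil_def)
    \<comment> \<open>Both zeros of \<open>c\<close> outside \<open>Q\<close> give back
      \<open>c\<close> itself, so the image of \<open>g\<close> loses at least one element.\<close>
    then have "g r = g s" using iff rs by metis
    then have "\<not> inj_on g ?R" using rs by (meson inj_onD)
    then have "card (g ` ?R) \<noteq> card ?R" using eq_card_imp_inj_on by blast
    then show ?thesis using le d card_Compl[OF Q] by simp
  qed
  then have "g ` ?R \<noteq> pencil c Q" using card_pencil[OF c Q] by auto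
  \<comment> \<open>A word of the pencil missed by \<open>g\<close> has no zero outside
    \<open>Q\<close>.\<close>
  then obtain b where b: "b \<in> pencil c Q" "b \<notin> g ` ?R" using g by blast
  have "\<forall>i\<in>?R. b i \<noteq> z" using iff b by blast
  then show ?thesis using b(1) by (auto simp: pencil_def)
qed

lemma obtain_nonzero: obtains a where "a \<in> A" "a \<noteq> z"
proof -
  have "A \<noteq> {z}" using card_A by auto
  then show ?thesis using that z_in by blast
qed

lemma support_exists_if_lt:
  assumes d: "n - k + 1 < card A" and S: "S \<subseteq> {..<n}" "n - k + 1 \<le> card S"
  shows "\<exists>c\<in>C. support z n c = S"
proof -
  obtain a where a: "a \<in> A" "a \<noteq> z" by (rule obtain_nonzero)
  have fS: "finite S" using S(1) by (rule finite_subset) simp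
  have cardS: "card S \<le> n" using card_mono[OF _ S(1)] by simp
  \<comment> \<open>This size gives the set \<open>Q\<close> below
    \<open>n - card S + card P = k - 1\<close> elements.\<close>
  obtain P where P: "P \<subseteq> S" "card P = card S - (n - k + 1)"
    using obtain_subset_with_card_n[of "card S - (n - k + 1)" S] by auto
  have fP: "finite P" using P(1) fS by (rule finite_subset)
  define Q where "Q = ({..<n} - S) \<union> P"
  have "card Q = n - card S + card P"
    unfolding Q_def using P S fS fP by (subst card_Un_disjoint) (auto simp: card_Diff_subset)
  then have Q: "Q \<subseteq> {..<n}" "card Q = k - 1"
    using P S k_pos k_le cardS by (auto simp: Q_def)
  have "{..<n} - Q \<noteq> {}" using card_Compl[OF Q] by force
  then obtain r where r: "r \<in> {..<n} - Q" by blast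
  have fQ: "finite Q" using Q(1) by (rule finite_subset) simp
  \<comment> \<open>Interpolation takes \<open>k\<close> points, so an arbitrary \<open>r\<close> is
    added; only the values on \<open>Q\<close> matter: zero off \<open>S\<close>, nonzero on
    \<open>P\<close>.\<close>
  have "\<exists>c\<in>C. \<forall>i\<in>insert r Q. c i = (if i \<in> P then a else z)"
    using Q r fQ a z_in k_pos by (intro interpolation) auto
  then obtain c where c: "c \<in> C" "\<And>i. i \<in> Q \<Longrightarrow> c i = (if i \<in> P then a else z)" by auto
  obtain b where b: "b \<in> C" "\<And>i. i \<in> Q \<Longrightarrow> b i = c i" "\<And>i. i \<in> {..<n} - Q \<Longrightarrow> b i \<noteq> z"
    using nowhere_zero_in_pencil[OF c(1) Q] d by blast
  have "b i \<noteq> z \<longleftrightarrow> i \<in> S" if i: "i < n" for i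
  proof (cases "i \<in> Q")
    case True
    then show ?thesis using b(2) c(2) a P by (auto simp: Q_def)
  next
    case False
    then show ?thesis using b(3) i by (auto simp: Q_def)
  qed
  then have "support z n b = S" using S by (auto simp: support_def)
  then show ?thesis using b(1) by blast
qed

text \<open>The complement of \<open>S\<close> has \<open>k - 1\<close> points, so some codeword
  vanishes there and is nonzero at a chosen point of \<open>S\<close>; a further zero in
  \<open>S\<close> would make \<open>k\<close> zeros and force the zero word.\<close>

lemma support_exists_min:
  assumes S: "S \<subseteq> {..<n}" "card S = n - k + 1"
  shows "\<exists>c\<in>C. support z n c = S"
proof -
  obtain a where a: "a \<in> A" "a \<noteq> z" by (rule obtain_nonzero)
  have fS: "finite S" using S(1) by (rule finite_subset) simp
  define Z where "Z = {..<n} - S"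
  have Z: "Z \<subseteq> {..<n}" "finite Z" "card Z = k - 1"
    using S fS k_pos k_le by (auto simp: Z_def card_Diff_subset)
  have "card S \<noteq> 0" using S(2) by simp
  then have "S \<noteq> {}" by auto
  then obtain s where s: "s \<in> S" by blast
  have sZ: "s < n" "s \<notin> Z" using s S by (auto simp: Z_def)
  have "\<exists>c\<in>C. \<forall>i\<in>insert s Z. c i = (if i = s then a else z)"
  proof (rule interpolation)
    show "insert s Z \<subseteq> {..<n}" using Z(1) sZ(1) by simp
    show "card (insert s Z) = k" using Z(2,3) sZ(2) k_pos by simp
  qed (use a(1) z_in in simp)
  then obtain c where c: "c \<in> C" "\<And>i. i \<in> insert s Z \<Longrightarrow> c i = (if i = s then a else z)"
    by blast
  have cs: "c s = a" using c(2) by simp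
  have cZ: "c i = z" if "i \<in> Z" for i using c(2) that sZ(2) by auto
  have "c r \<noteq> z" if r: "r \<in> S" for r
  proof
    assume cr: "c r = z"
    have "r \<notin> Z" using r by (simp add: Z_def)
    then have "k \<le> card (insert r Z)" using Z(2,3) by simp
    then have "c = zero_word z n"
      using Z(1) r c(1) S(1) cr cZ by (intro eq_zero_if_zeros[of c "insert r Z"]) auto
    then show False using cs a(2) sZ(1) by (simp add: zero_word_def)
  qed
  moreover have "c i = z" if "i < n" "i \<notin> S" for i
    using cZ that by (simp add: Z_def)
  ultimately have "support z n c = S" using S(1) unfolding support_def by blast
  then show ?thesis using c(1) by blast
qed

text \<open>The support of \<open>c\<close> has room for the \<open>t\<close> nonzero points
  \<open>P\<close>, and the last hypothesis leaves two zeros of \<open>c\<close> inside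
  \<open>S\<close>. They lie outside \<open>Q\<close>, as the second case of
  \<open>nowhere_zero_in_pencil\<close> requires.\<close>

lemma support_exists_step:
  assumes d: "n - k + 1 = card A" and S: "S \<subseteq> {..<n}" "card S = n - k + 1 + t"
    and c: "c \<in> C" "support z n c \<subseteq> S" "t \<le> card (support z n c)"
      "card (support z n c) + 2 \<le> card S"
  shows "\<exists>b\<in>C. support z n b = S"
proof -
  have fS: "finite S" using S(1) by (rule finite_subset) simp
  have cardS: "card S \<le> n" using card_mono[OF _ S(1)] by simp
  obtain P where P: "P \<subseteq> support z n c" "card P = t"
    using obtain_subset_with_card_n[OF c(3)] by auto
  have PS: "P \<subseteq> S" using P(1) c(2) by (rule subset_trans)
  have fP: "finite P" using PS fS by (rule finite_subset)
  define Q where "Q = ({..<n} - S) \<union> P"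
  have "card Q = n - card S + card P"
    unfolding Q_def using PS S fS fP by (subst card_Un_disjoint) (auto simp: card_Diff_subset)
  then have Q: "Q \<subseteq> {..<n}" "card Q = k - 1"
    using P PS S k_pos k_le cardS by (auto simp: Q_def)
  have "2 \<le> card (S - support z n c)"
    using c fS by (simp add: card_Diff_subset finite_subset)
  then obtain D where "D \<subseteq> S - support z n c" "card D = 2"
    using obtain_subset_with_card_n by metis
  then obtain r s where rs: "r \<in> S - support z n c" "s \<in> S - support z n c" "r \<noteq> s"
    by (auto simp: card_2_iff)
  have "\<exists>r\<in>{..<n} - Q. \<exists>s\<in>{..<n} - Q. r \<noteq> s \<and> c r = z \<and> c s = z"
    using rs S P by (intro bexI[of _ r] bexI[of _ s]) (auto simp: Q_def support_def)
  then obtain b where b: "b \<in> C" "\<And>i. i \<in> Q \<Longrightarrow> b i = c i" "\<And>i. i \<in> {..<n} - Q \<Longrightarrow> b i \<noteq> z"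
    using nowhere_zero_in_pencil[OF c(1) Q] d by blast
  have "b i \<noteq> z \<longleftrightarrow> i \<in> S" if i: "i < n" for i
  proof (cases "i \<in> Q")
    case True
    then show ?thesis using b(2) c(2) P PS i by (auto simp: Q_def support_def)
  next
    case False
    then show ?thesis using b(3) i by (auto simp: Q_def)
  qed
  then have "support z n b = S" using S by (auto simp: support_def)
  then show ?thesis using b(1) by blast
qed

lemma support_exists_if_eq:
  assumes d: "n - k + 1 = card A" and q: "2 < card A"
    and S: "S \<subseteq> {..<n}" "card S = n - k + 1 + t" and t: "t \<noteq> 1"
  shows "\<exists>c\<in>C. support z n c = S"
  using S t
proof (induction t arbitrary: S rule: less_induct)
  case (less t)
  show ?case
  proof (cases "t = 0")
    case True
    then show ?thesis using support_exists_min less.prems by simp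
  next
    case False
    \<comment> \<open>Dropping the excess by 2 provides the two zeros. From 3 this would reach the
      forbidden excess 1, so 0 is taken instead; the bound \<open>t \<le> card A + t'\<close> then
      reads \<open>3 \<le> card A\<close>, which is where \<open>2 < card A\<close> enters.\<close>
    define t' where "t' = (if t \<le> 3 then 0 else t - 2)"
    have t': "t' < t" "t' \<noteq> 1" "t' + 2 \<le> t" "t \<le> card A + t'"
      using False less.prems q by (auto simp: t'_def)
    have "n - k + 1 + t' \<le> card S" using less.prems(2) t'(1) by simp
    then obtain S' where S': "S' \<subseteq> S" "card S' = n - k + 1 + t'"
      using obtain_subset_with_card_n by metis
    have "S' \<subseteq> {..<n}" using S'(1) less.prems(1) by (rule subset_trans)
    then obtain c where c: "c \<in> C" "support z n c = S'"
      using less.IH[OF t'(1) _ S'(2) t'(2)] by blast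
    show ?thesis
    proof (rule support_exists_step[OF d less.prems(1,2) c(1)])
      show "support z n c \<subseteq> S" using c(2) S'(1) by simp
      show "t \<le> card (support z n c)" using c(2) S'(2) t'(4) d by simp
      show "card (support z n c) + 2 \<le> card S" using c(2) S'(2) t'(3) less.prems(2) by simp
    qed
  qed
qed

section \<open>The missing weight\<close>

lemma card_support_ne:
  assumes d: "n - k + 1 = card A" and k: "2 \<le> k" and c: "c \<in> C"
  shows "card (support z n c) \<noteq> n - k + 2"
proof
  define Z where "Z = {..<n} - support z n c"
  assume card: "card (support z n c) = n - k + 2"
  have fin: "finite (support z n c)" by (simp add: support_def)
  have "card Z = n - (n - k + 2)"
    unfolding Z_def using card card_Diff_subset[OF fin support_subset] by simp
  then have Z: "Z \<subseteq> {..<n}" "finite Z" "card Z = k - 2"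
    using k k_le by (simp_all add: Z_def)
  have "support z n c \<noteq> {}" using card by (metis card.empty add_2_eq_Suc' nat.distinct(1))
  \<comment> \<open>Fixing the nonzero value at \<open>p\<close> keeps the zero word out of the
    pencil.\<close>
  then obtain p where p: "p < n" "c p \<noteq> z" by (auto simp: support_def)
  have pZ: "p \<notin> Z" using p by (simp add: Z_def support_def)
  define Q where "Q = insert p Z"
  have Q: "Q \<subseteq> {..<n}" "card Q = k - 1" using Z p pZ k by (auto simp: Q_def)
  let ?R = "{..<n} - Q"
  obtain g where g: "g ` ?R \<subseteq> pencil c Q"
    and iff: "\<And>r b. r \<in> ?R \<Longrightarrow> b \<in> pencil c Q \<Longrightarrow> b r = z \<longleftrightarrow> b = g r"
    using pencil_zeros[OF c Q] by blast
  have "inj_on g ?R"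
  proof (rule inj_onI, rule ccontr)
    fix r s assume rs: "r \<in> ?R" "s \<in> ?R" "g r = g s" "r \<noteq> s"
    have gr: "g r \<in> pencil c Q" using g rs by blast
    have zeros: "g r r = z" "g r s = z" using iff[OF rs(1) gr] iff[OF rs(2) gr] rs(3) by auto
    \<comment> \<open>Two zeros outside \<open>Q\<close> and the \<open>k - 2\<close> fixed zeros in
      \<open>Z\<close> make \<open>k\<close> zeros.\<close>
    have "card (insert r (insert s Z)) = k" using Z rs k by (auto simp: Q_def)
    moreover have "g r i = z" if "i \<in> Z" for i
      using gr that by (auto simp: pencil_def Q_def Z_def support_def)
    ultimately have "g r = zero_word z n"
      using zeros gr Z rs by (intro eq_zero_if_zeros[of _ "insert r (insert s Z)"]) (auto simp: pencil_def)
    moreover have "g r p = c p" using gr by (simp add: pencil_def Q_def)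
    ultimately show False using p by (simp add: zero_word_def)
  qed
  \<comment> \<open>The pencil has as many words as there are coordinates outside \<open>Q\<close>,
    so an injective \<open>g\<close> hits every word, \<open>c\<close> included.\<close>
  then have "card (g ` ?R) = card (pencil c Q)"
    using card_Compl[OF Q] card_pencil[OF c Q] d by (simp add: card_image)
  moreover have "finite (pencil c Q)" using finite_C by (simp add: pencil_def)
  ultimately have eq: "g ` ?R = pencil c Q" using g card_subset_eq by blast
  have cQ: "c \<in> pencil c Q" using c by (simp add: pencil_def)
  then obtain r where r: "r \<in> ?R" "c = g r" using eq by blast
  have "c r = z" using iff[OF r(1) cQ] r(2) by (rule iffD2)
  \<comment> \<open>All zeros of \<open>c\<close> lie in \<open>Z\<close>, hence in
    \<open>Q\<close>.\<close>
  then show False using r(1) by (auto simp: Q_def Z_def support_def)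
qed

section \<open>From supports to the weight spectrum\<close>

lemma weight_spectrum_subset: "weight_spectrum z n C \<subseteq> {n - k + 1..n}"
proof
  fix w assume "w \<in> weight_spectrum z n C"
  then obtain c where c: "c \<in> C" "c \<noteq> zero_word z n" "w = hamming_weight z n c"
    by (auto simp: weight_spectrum_def)
  have "n - k + 1 \<le> w" using hamming_dist_ge[OF c(1) zero_in c(2)] c(3) by (simp add: hamming_weight_def)
  moreover have "w \<le> n"
    using card_mono[OF _ support_subset[of z n c]] c(3) by (simp add: hamming_weight_eq_card_support)
  ultimately show "w \<in> {n - k + 1..n}" by simp
qed

lemma weight_spectrumI:
  assumes w: "0 < w" "w \<le> n"
    and ex: "\<And>S. S \<subseteq> {..<n} \<Longrightarrow> card S = w \<Longrightarrow> \<exists>c\<in>C. support z n c = S"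
  shows "w \<in> weight_spectrum z n C"
proof -
  have "{..<w} \<subseteq> {..<n}" using w(2) by auto
  then obtain c where c: "c \<in> C" "support z n c = {..<w}" using ex card_lessThan by blast
  have "0 \<in> support z n c" using c(2) w(1) by simp
  then have "c \<noteq> zero_word z n" by (auto simp: support_def zero_word_def)
  moreover have "w = hamming_weight z n c" using c(2) by (simp add: hamming_weight_eq_card_support)
  ultimately show ?thesis using c(1) by (auto simp: weight_spectrum_def)
qed

lemma weight_spectrum_if_lt:
  assumes "n - k + 1 < card A"
  shows "weight_spectrum z n C = {n - k + 1..n}"
proof
  show "{n - k + 1..n} \<subseteq> weight_spectrum z n C"
  proof
    fix w assume w: "w \<in> {n - k + 1..n}"
    show "w \<in> weight_spectrum z n C"
    proof (rule weight_spectrumI)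
      fix S assume "S \<subseteq> {..<n}" "card S = w"
      then show "\<exists>c\<in>C. support z n c = S" using support_exists_if_lt[OF assms] w by simp
    qed (use w in auto)
  qed
qed (rule weight_spectrum_subset)

lemma weight_spectrum_if_eq:
  assumes d: "n - k + 1 = card A" and q: "2 < card A" and k: "2 \<le> k"
  shows "weight_spectrum z n C = {n - k + 1..n} - {n - k + 2}"
proof
  have "n - k + 2 \<notin> weight_spectrum z n C"
  proof
    assume "n - k + 2 \<in> weight_spectrum z n C"
    then obtain c where "c \<in> C" "n - k + 2 = card (support z n c)"
      unfolding weight_spectrum_def hamming_weight_eq_card_support by blast
    then show False using card_support_ne[OF d k] by metis
  qed
  then show "weight_spectrum z n C \<subseteq> {n - k + 1..n} - {n - k + 2}"
    using weight_spectrum_subset by blast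
  show "{n - k + 1..n} - {n - k + 2} \<subseteq> weight_spectrum z n C"
  proof
    fix w assume w: "w \<in> {n - k + 1..n} - {n - k + 2}"
    show "w \<in> weight_spectrum z n C"
    proof (rule weight_spectrumI)
      fix S assume S: "S \<subseteq> {..<n}" "card S = w"
      \<comment> \<open>The excess is 1 exactly for the removed weight
        \<open>n - k + 2\<close>.\<close>
      have "card S = n - k + 1 + (w - (n - k + 1))" "w - (n - k + 1) \<noteq> 1" using S(2) w by auto
      then show "\<exists>c\<in>C. support z n c = S" using support_exists_if_eq[OF d q S(1)] by blast
    qed (use w in auto)
  qed
qed

end

theorem theorem6:
  fixes A :: "'a set" and z :: 'a and q n k :: nat and C :: "(nat \<Rightarrow> 'a) set"
  assumes "finite A" and "card A = q" and "q \<ge> 2" and "z \<in> A"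
    and "1 \<le> k" and "k \<le> n"
    and "is_MDS_code A n k C"
    and "zero_word z n \<in> C"
  shows "(n < q + k - 1 \<longrightarrow> weight_spectrum z n C = {n - k + 1..n}) \<and>
         (n = q + k - 1 \<and> k > 2 \<and> q > 2 \<longrightarrow>
            weight_spectrum z n C = {n - k + 3..n} \<union> {n - k + 1} \<and>
            weight_spectrum z n C = {n - k + 1..n} - {n - k + 2})"
proof -
  interpret mds_code A z n k C
    using assms by unfold_locales auto
  have lt: "weight_spectrum z n C = {n - k + 1..n}" if "n < q + k - 1"
  proof (rule weight_spectrum_if_lt)
    show "n - k + 1 < card A" using that \<open>card A = q\<close> k_le by linarith
  qed
  have eq: "weight_spectrum z n C = {n - k + 1..n} - {n - k + 2}"
    if "n = q + k - 1" "k > 2" "q > 2"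
  proof (rule weight_spectrum_if_eq)
    show "n - k + 1 = card A" using that \<open>card A = q\<close> by linarith
  qed (use that \<open>card A = q\<close> in simp_all)
  \<comment> \<open>From \<open>1 \<le> k\<close> and \<open>k \<le> n\<close> the endpoint
    \<open>n - k + 1\<close> is at most \<open>n\<close>, so it does lie in the interval.\<close>
  have "{n - k + 1..n} - {n - k + 2} = {n - k + 3..n} \<union> {n - k + 1}"
    using k_pos k_le by auto
  then show ?thesis using lt eq by metis
qed

end
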